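(* Let $K$ be a field and let $G$ be a graph. Then $$\operatorname{assrad}(I(G)^{(k)})\subset\operatorname{assrad}(I(G)^{k})\quad\text{for }k=2,3.$$
   Context: All graphs are finite, without loops and multiple edges. For a graph $G$ on vertex set $[n]=\{1,\dots,n\}$ and the polynomial ring $S=K[x_1,\dots,x_n]$, the edge ideal is $I(G)=(x_ix_j : \{i,j\}\in E(G))\subset S$. For a squarefree monomial ideal $I$, the $k$-th symbolic power is $I^{(k)}=\bigcap_{P\in\operatorname{Min}(I)}P^k$, where $\operatorname{Min}(I)$ is the set of minimal primes of $I$; $I^k$ is the ordinary power. For a monomial ideal $I\subset S$, the set of associated radical ideals of $I$ is $$\operatorname{assrad}(I)=\{\sqrt{I:u} : u\text{ is a monomial of }S\text{ with }u\notin I\}.$$ *)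

theory Defs
  imports "HOL-Library.Poly_Mapping" "HOL-Algebra.Algebra" "HOL-Algebra.Algebraic_Closure_Type"
begin

section \<open>Polynomial rings and ideals\<close>

text \<open>
  A polynomial is a finitely supported map from exponent vectors to coefficients. The variables
  are indexed by a type \<open>'v\<close>; for a finite type with \<open>n\<close> elements
  this is the polynomial ring in \<open>n\<close> variables over \<open>'k\<close>. Multiplication is the
  convolution product of \<open>Poly_Mapping\<close>.
\<close>

type_synonym ('v, 'k) mpol = "('v \<Rightarrow>\<^sub>0 nat) \<Rightarrow>\<^sub>0 'k"

abbreviation mpol_ring :: "('v, 'k::field) mpol ring" where
  "mpol_ring \<equiv> ring_of_type_algebra"

definition monomial :: "('v \<Rightarrow>\<^sub>0 nat) \<Rightarrow> ('v, 'k::field) mpol" where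
  "monomial t = Poly_Mapping.single t 1"

definition var :: "'v \<Rightarrow> ('v, 'k::field) mpol" where
  "var i = monomial (Poly_Mapping.single i 1)"

text \<open>Powers are taken in the monoid of ideals, whose unit is the whole ring.\<close>

definition ideal_power :: "('a, 'b) ring_scheme \<Rightarrow> 'a set \<Rightarrow> nat \<Rightarrow> 'a set" where
  "ideal_power R I k = I [^]\<^bsub>ideals_set R\<^esub> k"

definition minimal_primes :: "('a, 'b) ring_scheme \<Rightarrow> 'a set \<Rightarrow> 'a set set" where
  "minimal_primes R I = {P. primeideal P R \<and> I \<subseteq> P \<and>
     (\<forall>Q. primeideal Q R \<and> I \<subseteq> Q \<and> Q \<subseteq> P \<longrightarrow> Q = P)}"

text \<open>
  This agrees with the usual symbolic power for squarefree monomial ideals, whose minimal primes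
  are generated by variables; for general ideals the two may differ. Intersecting with the carrier only
  matters when there are no minimal primes, that is, for the unit ideal.
\<close>

definition symbolic_power :: "('a, 'b) ring_scheme \<Rightarrow> 'a set \<Rightarrow> nat \<Rightarrow> 'a set" where
  "symbolic_power R I k = carrier R \<inter> (\<Inter>P\<in>minimal_primes R I. ideal_power R P k)"

definition colon :: "('a, 'b) ring_scheme \<Rightarrow> 'a set \<Rightarrow> 'a \<Rightarrow> 'a set" where
  "colon R I u = {f \<in> carrier R. f \<otimes>\<^bsub>R\<^esub> u \<in> I}"

definition ideal_radical :: "('a, 'b) ring_scheme \<Rightarrow> 'a set \<Rightarrow> 'a set" where
  "ideal_radical R I = {f \<in> carrier R. \<exists>n::nat. n > 0 \<and> f [^]\<^bsub>R\<^esub> n \<in> I}"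

text \<open>Here \<open>I\<close> is meant to be a monomial ideal.\<close>

definition assrad :: "('v, 'k::field) mpol set \<Rightarrow> ('v, 'k) mpol set set" where
  "assrad I = {ideal_radical mpol_ring (colon mpol_ring I (monomial t)) | t. monomial t \<notin> I}"

section \<open>Graphs\<close>

text \<open>
  A graph whose vertices are all the elements of \<open>'v\<close> is given by its set of edges,
  each edge being a set of exactly two vertices.
\<close>

definition is_graph :: "'v set set \<Rightarrow> bool" where
  "is_graph E \<longleftrightarrow> (\<forall>e\<in>E. card e = 2)"

definition edge_ideal :: "'v set set \<Rightarrow> ('v, 'k::field) mpol set" where
  "edge_ideal E = Idl\<^bsub>mpol_ring\<^esub> {var i * var j | i j. {i, j} \<in> E}"

end

theory Submission
  imports Defs
begin

text \<open>
  All ideals involved are spanned by monomials, so the theorem is a statement about exponent vectors.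
  The minimal primes of an edge ideal \<open>I\<close> are generated by the minimal vertex covers. Hence
  \<open>x\<^sup>t\<close> lies in the \<open>k\<close>-th symbolic power iff every vertex cover \<open>C\<close> has weight
  \<open>weight C t \<ge> k\<close> (lemma \<open>symbolic_power_edge_ideal\<close>), whereas it lies in \<open>I\<^sup>k\<close>
  iff \<open>t\<close> dominates a sum of \<open>k\<close> edges. A monomial \<open>x\<^sup>t\<close> lies in the radical of
  \<open>J : x\<^sup>u\<close> iff \<open>x\<^sup>u\<close> times a high power of \<open>x\<^sup>t\<close> lies in \<open>J\<close>, so only the support
  \<open>F\<close> of \<open>t\<close> matters.

  Let \<open>x\<^sup>u\<close> lie outside the symbolic power. Often \<open>v = u\<close> yields the same radical
  for \<open>I\<^sup>k\<close>. To compare, let \<open>F\<close> be independent and \<open>W\<close> its set of neighbours. Every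
  factor of \<open>x\<^sup>u\<close> in \<open>W\<close> can be matched into \<open>F\<close>, where there are arbitrarily many
  copies, and it also counts in every cover that avoids \<open>F\<close>. So with \<open>m = weight W u\<close> both
  membership questions reduce to the exponent \<open>k - m\<close> for the part of \<open>u\<close> away from \<open>W\<close>
  and \<open>F\<close>. If \<open>m = 0\<close> then \<open>u\<close> itself would be in the symbolic power; and the
  first powers agree. As \<open>k \<le> 3\<close>, the only interesting case is \<open>k = 3\<close>, \<open>m = 1\<close>,
  where symbolic and ordinary squares are compared, and these differ only by triangles all of whose
  vertices have exponent one (lemma \<open>symbolic_square\<close>).

  If \<open>u\<close> contains such a triangle \<open>T\<close>, the exponents of \<open>u\<close> outside \<open>T\<close> are doubled
  to get \<open>v\<close>. In the critical case the single factor in \<open>W\<close> then counts twice, and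
  together with one edge of \<open>T\<close> it gives three edges (lemma \<open>symbolic_to_ordinary\<close>). Doubling
  does not create anything new, because every cover already has weight two on \<open>T\<close>: if it meets the
  support of \<open>u\<close> outside \<open>T\<close>, its weight on \<open>u\<close> is at least three, and otherwise it has
  the same weight on \<open>u\<close> and on \<open>v\<close> (lemma \<open>double_off_weight\<close>).
\<close>

abbreviation lookup :: "('a \<Rightarrow>\<^sub>0 'b::zero) \<Rightarrow> 'a \<Rightarrow> 'b" where
  "lookup \<equiv> Poly_Mapping.lookup"

abbreviation keys :: "('a \<Rightarrow>\<^sub>0 'b::zero) \<Rightarrow> 'a set" where
  "keys \<equiv> Poly_Mapping.keys"

section \<open>Exponent vectors of powers and of symbolic powers\<close>

primrec exponent_power :: "('v \<Rightarrow>\<^sub>0 nat) set \<Rightarrow> nat \<Rightarrow> ('v \<Rightarrow>\<^sub>0 nat) set" where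
  "exponent_power M 0 = UNIV"
| "exponent_power M (Suc k) = {a + b | a b. a \<in> exponent_power M k \<and> b \<in> M}"

definition upward_closed :: "('v \<Rightarrow>\<^sub>0 nat) set \<Rightarrow> bool" where
  "upward_closed M \<longleftrightarrow> (\<forall>s\<in>M. \<forall>t. t + s \<in> M)"

definition edge_exponents :: "'v set set \<Rightarrow> ('v \<Rightarrow>\<^sub>0 nat) set" where
  "edge_exponents E = {t. \<exists>x y. {x, y} \<in> E \<and> 0 < lookup t x \<and> 0 < lookup t y}"

definition cover_exponents :: "'v set \<Rightarrow> ('v \<Rightarrow>\<^sub>0 nat) set" where
  "cover_exponents C = {t. \<exists>x\<in>C. 0 < lookup t x}"

definition vertex_cover :: "'v set set \<Rightarrow> 'v set \<Rightarrow> bool" where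
  "vertex_cover E C \<longleftrightarrow> (\<forall>e\<in>E. e \<inter> C \<noteq> {})"

definition weight :: "'v set \<Rightarrow> ('v::finite \<Rightarrow>\<^sub>0 nat) \<Rightarrow> nat" where
  "weight C t = (\<Sum>x\<in>C. lookup t x)"

text \<open>
  All vertex covers are used rather than the minimal ones; the condition is the same because the
  weight is monotone in the cover.
\<close>
definition symbolic_exponents :: "'v::finite set set \<Rightarrow> nat \<Rightarrow> ('v \<Rightarrow>\<^sub>0 nat) set" where
  "symbolic_exponents E k = {t. \<forall>C. vertex_cover E C \<longrightarrow> k \<le> weight C t}"

text \<open>
  Over a finite set of variables every function is an exponent vector.
\<close>
definition exponent_of :: "('v::finite \<Rightarrow> nat) \<Rightarrow> ('v \<Rightarrow>\<^sub>0 nat)" where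
  "exponent_of f = Abs_poly_mapping f"

lemma lookup_exponent_of [simp]: "lookup (exponent_of f) x = f x"
  by (simp add: exponent_of_def)

lemma exponent_eqI:
  "(\<And>x. lookup s x = lookup t x) \<Longrightarrow> s = t"
  by (rule poly_mapping_eqI)

lemma exponent_difference:
  fixes s t :: "'v::finite \<Rightarrow>\<^sub>0 nat"
  assumes "\<And>x. lookup s x \<le> lookup t x"
  obtains r where "t = r + s"
proof
  show "t = exponent_of (\<lambda>x. lookup t x - lookup s x) + s"
    using assms by (intro exponent_eqI) (simp add: lookup_add)
qed

lemma split_off_variable:
  fixes t :: "'v::finite \<Rightarrow>\<^sub>0 nat"
  assumes "0 < lookup t x"
  obtains r where "t = r + Poly_Mapping.single x 1"
  using exponent_difference[of "Poly_Mapping.single x 1" t] assms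
  by (metis One_nat_def Suc_leI less_eq_nat.simps(1) lookup_single_eq lookup_single_not_eq)

lemma weight_add [simp]: "weight C (s + t) = weight C s + weight C t"
  by (simp add: weight_def lookup_add sum.distrib)

lemma weight_mono: "(\<And>x. lookup s x \<le> lookup t x) \<Longrightarrow> weight C s \<le> weight C t"
  by (simp add: weight_def sum_mono)

lemma weight_le: "x \<in> C \<Longrightarrow> lookup t x \<le> weight C t"
  by (simp add: weight_def member_le_sum)

lemma weight_pos_iff: "0 < weight C t \<longleftrightarrow> (\<exists>x\<in>C. 0 < lookup t x)"
  by (auto simp: weight_def sum_eq_0_iff simp flip: neq0_conv)

lemma upward_closed_power:
  assumes "upward_closed M"
  shows "upward_closed (exponent_power M k)"
proof (cases k)
  case (Suc k)
  then show ?thesis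
    using assms unfolding upward_closed_def by clarsimp (metis add.left_commute)
qed (simp add: upward_closed_def)

lemma upward_closed_edge: "upward_closed (edge_exponents E)"
  by (auto simp: upward_closed_def edge_exponents_def lookup_add)

lemma upward_closed_cover: "upward_closed (cover_exponents C)"
  by (auto simp: upward_closed_def cover_exponents_def lookup_add)

lemma exponent_power_add:
  "s \<in> exponent_power M m \<Longrightarrow> t \<in> exponent_power M n \<Longrightarrow> upward_closed M \<Longrightarrow>
    s + t \<in> exponent_power M (m + n)"
proof (induction n arbitrary: t)
  case 0
  then show ?case
    using upward_closed_power[of M m] by (simp add: upward_closed_def add.commute)
next
  case (Suc n)
  then show ?case by clarsimp (metis add.assoc)
qed

lemma exponent_power_mono:
  fixes s t :: "'v::finite \<Rightarrow>\<^sub>0 nat"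
  assumes "s \<in> exponent_power M k" "upward_closed M" "\<And>x. lookup s x \<le> lookup t x"
  shows "t \<in> exponent_power M k"
proof -
  obtain r where "t = r + s" using exponent_difference[of s t] assms(3) by blast
  with assms upward_closed_power[of M k] show ?thesis by (simp add: upward_closed_def)
qed

lemma in_exponent_power_one: "s \<in> M \<Longrightarrow> s \<in> exponent_power M 1"
proof -
  assume "s \<in> M"
  moreover have "s = 0 + s" by simp
  ultimately show ?thesis
    unfolding One_nat_def exponent_power.simps mem_Collect_eq by blast
qed

lemma exponent_power_subset: "M \<subseteq> N \<Longrightarrow> exponent_power M k \<subseteq> exponent_power N k"
  by (induction k) auto

lemma exponent_power_cover:
  fixes C :: "'v::finite set"
  shows "exponent_power (cover_exponents C) k = {t. k \<le> weight C t}"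
proof (induction k)
  case (Suc k)
  show ?case
  proof (intro equalityI subsetI)
    fix t assume "t \<in> exponent_power (cover_exponents C) (Suc k)"
    then obtain a b where "t = a + b" "a \<in> exponent_power (cover_exponents C) k" "0 < weight C b"
      unfolding exponent_power.simps weight_pos_iff by (auto simp: cover_exponents_def)
    then show "t \<in> {t. Suc k \<le> weight C t}" by (simp add: Suc)
  next
    fix t assume "t \<in> {t. Suc k \<le> weight C t}"
    then have w: "Suc k \<le> weight C t" by simp
    then obtain x where x: "x \<in> C" "0 < lookup t x" using weight_pos_iff[of C t] by auto
    obtain r where r: "t = r + Poly_Mapping.single x 1" using split_off_variable[OF x(2)] .
    have "weight C (Poly_Mapping.single x 1) = 1"
      using x by (simp add: weight_def lookup_single when_def)
    then have "r \<in> exponent_power (cover_exponents C) k" using w r by (simp add: Suc)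
    moreover have "Poly_Mapping.single x 1 \<in> cover_exponents C"
      using x by (auto simp: cover_exponents_def intro!: bexI[of _ x])
    ultimately show "t \<in> exponent_power (cover_exponents C) (Suc k)" using r by auto
  qed
qed simp

lemma edge_exponents_subset_cover:
  "vertex_cover E C \<Longrightarrow> edge_exponents E \<subseteq> cover_exponents C"
  unfolding edge_exponents_def cover_exponents_def vertex_cover_def by fastforce

text \<open>
  Each edge contributes at least one to the weight of a cover.
\<close>
lemma edge_power_subset_symbolic:
  "exponent_power (edge_exponents E) k \<subseteq> symbolic_exponents E k"
proof
  fix t assume t: "t \<in> exponent_power (edge_exponents E) k"
  have "k \<le> weight C t" if "vertex_cover E C" for C
  proof -
    have "edge_exponents E \<subseteq> cover_exponents C" by (rule edge_exponents_subset_cover[OF that])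
    then have "exponent_power (edge_exponents E) k \<subseteq> exponent_power (cover_exponents C) k"
      by (rule exponent_power_subset)
    then show ?thesis using t exponent_power_cover by blast
  qed
  then show "t \<in> symbolic_exponents E k" by (simp add: symbolic_exponents_def)
qed

lemma symbolic_exponents_mono:
  "s \<in> symbolic_exponents E k \<Longrightarrow> (\<And>x. lookup s x \<le> lookup t x) \<Longrightarrow> t \<in> symbolic_exponents E k"
  unfolding symbolic_exponents_def mem_Collect_eq using weight_mono[of s t] le_trans by blast

lemma graph_edgeE:
  assumes "is_graph E" "e \<in> E"
  obtains x y where "e = {x, y}" "x \<noteq> y"
  using assms unfolding is_graph_def by (metis card_2_iff)

text \<open>
  Adding to \<open>A\<close> all vertices outside the support of \<open>t\<close> does not change its weight, so the
  result is too light to be a cover.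
\<close>
lemma symbolic_edge_avoiding:
  assumes "is_graph E" "t \<in> symbolic_exponents E k" "weight A t < k"
  obtains x y where "{x, y} \<in> E" "x \<noteq> y" "x \<notin> A" "y \<notin> A" "0 < lookup t x" "0 < lookup t y"
proof -
  have "weight (A \<union> {x. lookup t x = 0}) t \<le> weight A t"
  proof -
    have "weight (A \<union> {x. lookup t x = 0}) t = weight A t"
      unfolding weight_def by (rule sum.mono_neutral_right) auto
    then show ?thesis by simp
  qed
  then have "\<not> vertex_cover E (A \<union> {x. lookup t x = 0})"
    using assms(2,3) by (force simp: symbolic_exponents_def)
  then obtain e where e: "e \<in> E" "e \<inter> (A \<union> {x. lookup t x = 0}) = {}"
    by (auto simp: vertex_cover_def)
  obtain x y where "e = {x, y}" "x \<noteq> y" using graph_edgeE[OF assms(1) e(1)] .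
  with e that[of x y] show ?thesis by auto
qed

lemma symbolic_first_power:
  assumes "is_graph E" "t \<in> symbolic_exponents E 1"
  shows "t \<in> edge_exponents E"
proof -
  have "weight {} t < 1" by (simp add: weight_def)
  from symbolic_edge_avoiding[OF assms this] show ?thesis
    unfolding edge_exponents_def by blast
qed

section \<open>Ordinary and symbolic squares\<close>

lemma edge_in_edge_exponents:
  "{x, y} \<in> E \<Longrightarrow> Poly_Mapping.single x 1 + Poly_Mapping.single y 1 \<in> edge_exponents E"
  unfolding edge_exponents_def mem_Collect_eq
  by (rule exI[of _ x], rule exI[of _ y]) (simp add: lookup_add)

lemma two_edges_in_square:
  fixes E :: "'v::finite set set"
  assumes "{a, b} \<in> E" "{c, d} \<in> E"
    and "\<And>x. of_bool (a = x) + of_bool (b = x) + of_bool (c = x) + of_bool (d = x) \<le> lookup t x"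
  shows "t \<in> exponent_power (edge_exponents E) 2"
proof (rule exponent_power_mono)
  let ?v = "\<lambda>x. Poly_Mapping.single x (1::nat)"
  have "(?v a + ?v b) + (?v c + ?v d) \<in> exponent_power (edge_exponents E) (1 + 1)"
    by (intro exponent_power_add in_exponent_power_one edge_in_edge_exponents assms upward_closed_edge)
  then show "(?v a + ?v b) + (?v c + ?v d) \<in> exponent_power (edge_exponents E) 2"
    by (simp only: one_add_one)
  show "lookup ((?v a + ?v b) + (?v c + ?v d)) x \<le> lookup t x" for x
    using assms(3)[of x] by (simp only: lookup_add lookup_single when_def of_bool_def add.assoc)
qed (rule upward_closed_edge)

definition triangle :: "'v set set \<Rightarrow> 'v \<Rightarrow> 'v \<Rightarrow> 'v \<Rightarrow> bool" where
  "triangle E a b c \<longleftrightarrow> {a, b} \<in> E \<and> {b, c} \<in> E \<and> {a, c} \<in> E \<and> a \<noteq> b \<and> b \<noteq> c \<and> a \<noteq> c"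

lemma triangle_square:
  fixes E :: "'v::finite set set"
  assumes "triangle E a b c" "0 < lookup t a" "0 < lookup t b" "0 < lookup t c"
    and "1 < lookup t a \<or> 1 < lookup t b \<or> 1 < lookup t c"
  shows "t \<in> exponent_power (edge_exponents E) 2"
  using assms(5)
proof (elim disjE)
  assume "1 < lookup t a"
  then show ?thesis using assms by (intro two_edges_in_square[of a b _ a c]) (auto simp: triangle_def of_bool_def)
next
  assume "1 < lookup t b"
  then show ?thesis using assms by (intro two_edges_in_square[of a b _ b c]) (auto simp: triangle_def of_bool_def)
next
  assume "1 < lookup t c"
  then show ?thesis using assms by (intro two_edges_in_square[of a c _ b c]) (auto simp: triangle_def of_bool_def)
qed

text \<open>
  Take an edge \<open>ab\<close> in the support of \<open>t\<close>. If \<open>a\<close> has exponent one, then \<open>{a}\<close> is too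
  light, so some edge avoids \<open>a\<close>; it must pass through \<open>b\<close>, since two disjoint edges would put
  \<open>t\<close> in the square. The same holds with \<open>a\<close> and \<open>b\<close> exchanged. Neither end can have a larger
  exponent: \<open>ab\<close> would go together with a second copy of itself or with the other edge at that end.
  The two further edges, at \<open>a\<close> and at \<open>b\<close>, cannot be disjoint either, so they share their far
  end and close up a triangle with \<open>ab\<close>. Its third vertex has exponent one because a triangle with a
  repeated vertex contains two edges at that vertex.
\<close>
lemma symbolic_square:
  fixes E :: "'v::finite set set"
  assumes "is_graph E" "t \<in> symbolic_exponents E 2" "t \<notin> exponent_power (edge_exponents E) 2"
  obtains a b c where "triangle E a b c" "lookup t a = 1" "lookup t b = 1" "lookup t c = 1"
proof -
  obtain a b where ab: "{a, b} \<in> E" "a \<noteq> b" "0 < lookup t a" "0 < lookup t b"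
  proof -
    have "weight {} t < 2" by (simp add: weight_def)
    from symbolic_edge_avoiding[OF assms(1,2) this] that show ?thesis by blast
  qed
  have other: "\<exists>z. {y, z} \<in> E \<and> z \<noteq> x \<and> z \<noteq> y \<and> 0 < lookup t z"
    if xy: "{x, y} \<in> E" "x \<noteq> y" "0 < lookup t x" "0 < lookup t y" "lookup t x < 2" for x y
  proof -
    have "weight {x} t < 2" using xy by (simp add: weight_def)
    then obtain p q where pq: "{p, q} \<in> E" "p \<noteq> q" "p \<noteq> x" "q \<noteq> x" "0 < lookup t p" "0 < lookup t q"
      using symbolic_edge_avoiding[OF assms(1,2), of "{x}"] by blast
    have "p = y \<or> q = y"
    proof (rule ccontr)
      assume "\<not> (p = y \<or> q = y)"
      then have "t \<in> exponent_power (edge_exponents E) 2"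
        using xy pq by (intro two_edges_in_square[of x y _ p q]) (auto simp: of_bool_def)
      with assms(3) show False ..
    qed
    with pq show ?thesis by (metis insert_commute)
  qed
  have one: "lookup t x < 2" if xy: "{x, y} \<in> E" "x \<noteq> y" "0 < lookup t x" "0 < lookup t y" for x y
  proof (rule ccontr)
    assume x: "\<not> lookup t x < 2"
    show False
    proof (cases "lookup t y < 2")
      case True
      have "{y, x} \<in> E" using xy by (simp add: insert_commute)
      then obtain z where "{x, z} \<in> E" "z \<noteq> x" "z \<noteq> y" "0 < lookup t z"
        using other[of y x] xy True by auto
      then have "t \<in> exponent_power (edge_exponents E) 2"
        using xy x by (intro two_edges_in_square[of x y _ x z]) (auto simp: of_bool_def)
      with assms(3) show False ..
    next
      case False
      then have "t \<in> exponent_power (edge_exponents E) 2"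
        using xy x by (intro two_edges_in_square[of x y _ x y]) (auto simp: of_bool_def)
      with assms(3) show False ..
    qed
  qed
  have ba: "{b, a} \<in> E" using ab by (simp add: insert_commute)
  have ta: "lookup t a < 2" and tb: "lookup t b < 2" using one[of a b] one[of b a] ab ba by auto
  obtain y where y: "{b, y} \<in> E" "y \<noteq> a" "y \<noteq> b" "0 < lookup t y"
    using other[of a b] ab ta by auto
  obtain x where x: "{a, x} \<in> E" "x \<noteq> a" "x \<noteq> b" "0 < lookup t x"
    using other[of b a] ab ba tb by auto
  have "x = y"
  proof (rule ccontr)
    assume "x \<noteq> y"
    then have "t \<in> exponent_power (edge_exponents E) 2"
      using ab x y by (intro two_edges_in_square[of a x _ b y]) (auto simp: of_bool_def)
    with assms(3) show False ..
  qed
  with ab x y have tri: "triangle E a b x" by (auto simp: triangle_def)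
  then have "\<not> 1 < lookup t x"
    using triangle_square[OF tri, of t] ab(3,4) x(4) assms(3) by blast
  then have "lookup t x = 1" "lookup t a = 1" "lookup t b = 1" using x ab ta tb by linarith+
  with tri show ?thesis by (intro that)
qed

section \<open>Splitting along an independent set\<close>

definition scaled :: "nat \<Rightarrow> ('v::finite \<Rightarrow>\<^sub>0 nat) \<Rightarrow> ('v \<Rightarrow>\<^sub>0 nat)" where
  "scaled n t = exponent_of (\<lambda>x. n * lookup t x)"

lemma lookup_scaled [simp]: "lookup (scaled n t) x = n * lookup t x"
  by (simp add: scaled_def)

lemma scaled_Suc: "scaled (Suc n) t = scaled n t + t"
  by (rule exponent_eqI) (simp add: lookup_add)

lemma scaled_0 [simp]: "scaled 0 t = 0"
  by (rule exponent_eqI) simp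

definition part_on :: "'v set \<Rightarrow> ('v::finite \<Rightarrow>\<^sub>0 nat) \<Rightarrow> ('v \<Rightarrow>\<^sub>0 nat)" where
  "part_on A t = exponent_of (\<lambda>x. if x \<in> A then lookup t x else 0)"

lemma lookup_part_on: "lookup (part_on A t) x = (if x \<in> A then lookup t x else 0)"
  by (simp add: part_on_def)

definition neighbours :: "'v set set \<Rightarrow> 'v set \<Rightarrow> 'v set" where
  "neighbours E F = {x. \<exists>y\<in>F. {x, y} \<in> E}"

lemma weight_subset_mono: "A \<subseteq> C \<Longrightarrow> weight A t \<le> weight C t"
  by (simp add: weight_def sum_mono2)

lemma scaled_edge_exponent:
  "t \<in> edge_exponents E \<Longrightarrow> scaled k t \<in> exponent_power (edge_exponents E) k"
  by (induction k) (auto simp: scaled_Suc)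

text \<open>
  Each unit of \<open>s\<close> on a neighbour of the support of \<open>t\<close> is matched with a fresh copy of
  \<open>t\<close>, which contains the other end of an edge.
\<close>
lemma matching_into_support:
  fixes s t :: "'v::finite \<Rightarrow>\<^sub>0 nat"
  assumes "m \<le> weight (neighbours E (keys t)) s"
  shows "scaled m t + s \<in> exponent_power (edge_exponents E) m"
  using assms
proof (induction m arbitrary: s)
  case (Suc m)
  let ?W = "neighbours E (keys t)"
  have "0 < weight ?W s" using Suc.prems by simp
  then obtain x where x: "x \<in> ?W" "0 < lookup s x" unfolding weight_pos_iff by blast
  then obtain y where y: "{x, y} \<in> E" "0 < lookup t y"
    by (auto simp: neighbours_def in_keys_iff)
  obtain r where r: "s = r + Poly_Mapping.single x 1" using split_off_variable[OF x(2)] .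
  have "weight ?W (Poly_Mapping.single x 1) = 1"
    using x by (simp add: weight_def lookup_single when_def)
  then have "scaled m t + r \<in> exponent_power (edge_exponents E) m"
    using Suc.prems r by (intro Suc.IH) simp
  moreover have "t + Poly_Mapping.single x 1 \<in> edge_exponents E"
    unfolding edge_exponents_def mem_Collect_eq using y
    by - (rule exI[of _ x], rule exI[of _ y], simp add: lookup_add)
  moreover have "scaled (Suc m) t + s = (scaled m t + r) + (t + Poly_Mapping.single x 1)"
    by (simp add: scaled_Suc r ac_simps)
  ultimately show ?case by (simp only: exponent_power.simps) blast
qed simp

text \<open>
  A cover \<open>C\<close> can be replaced by \<open>W \<union> (C - F)\<close>, where \<open>F\<close> is the support of \<open>t\<close> and
  \<open>W\<close> its neighbourhood: every edge that meets \<open>F\<close> has its other end in \<open>W\<close>. The new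
  cover is disjoint from \<open>F\<close>, so \<open>t\<close> does not contribute to its weight.
\<close>
lemma symbolic_rest:
  fixes E :: "'v::finite set set"
  assumes graph: "is_graph E" and indep: "t \<notin> edge_exponents E"
    and tu: "t + u \<in> symbolic_exponents E k"
  shows "part_on (- (neighbours E (keys t) \<union> keys t)) u
           \<in> symbolic_exponents E (k - weight (neighbours E (keys t)) u)"
proof -
  let ?F = "keys t" and ?W = "neighbours E (keys t)"
  let ?r = "part_on (- (?W \<union> ?F)) u"
  have disj: "?W \<inter> ?F = {}"
    using indep by (auto simp: neighbours_def edge_exponents_def in_keys_iff)
  have "k - weight ?W u \<le> weight C ?r" if C: "vertex_cover E C" for C
  proof -
    let ?C = "?W \<union> (C - ?F)"
    have "vertex_cover E ?C"
      unfolding vertex_cover_def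
    proof
      fix e assume e: "e \<in> E"
      obtain x y where xy: "e = {x, y}" using graph_edgeE[OF graph e] by metis
      have "x \<in> ?F \<Longrightarrow> y \<in> ?W" "y \<in> ?F \<Longrightarrow> x \<in> ?W"
        using e xy by (auto simp: neighbours_def insert_commute)
      moreover have "x \<in> C \<or> y \<in> C" using C e xy by (auto simp: vertex_cover_def)
      ultimately show "e \<inter> ?C \<noteq> {}" using xy by blast
    qed
    then have "k \<le> weight ?C t + weight ?C u"
      using tu unfolding symbolic_exponents_def weight_add[symmetric] by blast
    moreover have "weight ?C t = 0"
      unfolding weight_def using disj by (intro sum.neutral) (auto simp: in_keys_iff)
    moreover have "weight ?C u \<le> weight ?W u + weight C ?r"
    proof -
      have "weight ?C u = weight ?W u + weight (C - ?F - ?W) u"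
        unfolding weight_def by (subst sum.union_disjoint[symmetric]) (auto intro: sum.cong)
      also have "weight (C - ?F - ?W) u = weight (C - ?F - ?W) ?r"
        unfolding weight_def by (intro sum.cong) (auto simp: lookup_part_on)
      also have "\<dots> \<le> weight C ?r" by (intro weight_subset_mono) auto
      finally show ?thesis by simp
    qed
    ultimately show ?thesis by linarith
  qed
  then show ?thesis by (simp add: symbolic_exponents_def)
qed

text \<open>
  Of the \<open>k\<close> edges, \<open>m\<close> go from the neighbours of the support of \<open>t\<close> into that support; the other
  edges are taken from the rest of \<open>v\<close>.
\<close>
lemma power_from_rest:
  fixes E :: "'v::finite set set"
  assumes m: "m \<le> k" "m \<le> weight (neighbours E (keys t)) v"
    and rest: "part_on (- (neighbours E (keys t) \<union> keys t)) v
                 \<in> exponent_power (edge_exponents E) (k - m)"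
  shows "scaled k t + v \<in> exponent_power (edge_exponents E) k"
proof (rule exponent_power_mono)
  let ?F = "keys t" and ?W = "neighbours E (keys t)"
  have "weight ?W (part_on ?W v) = weight ?W v"
    unfolding weight_def by (intro sum.cong) (auto simp: lookup_part_on)
  then have "scaled m t + part_on ?W v \<in> exponent_power (edge_exponents E) m"
    using m by (intro matching_into_support) simp
  from exponent_power_add[OF this rest upward_closed_edge] m(1)
  show "scaled m t + part_on ?W v + part_on (- (?W \<union> ?F)) v \<in> exponent_power (edge_exponents E) k"
    by simp
  show "lookup (scaled m t + part_on ?W v + part_on (- (?W \<union> ?F)) v) x \<le> lookup (scaled k t + v) x" for x
    using mult_le_mono1[OF m(1), of "lookup t x"] by (simp add: lookup_add lookup_part_on trans_le_add1)
qed (rule upward_closed_edge)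

section \<open>The modified multiplier\<close>

definition simple_triangle :: "'v set set \<Rightarrow> ('v \<Rightarrow>\<^sub>0 nat) \<Rightarrow> 'v set \<Rightarrow> bool" where
  "simple_triangle E u T \<longleftrightarrow>
     (\<exists>a b c. T = {a, b, c} \<and> triangle E a b c \<and> lookup u a = 1 \<and> lookup u b = 1 \<and> lookup u c = 1)"

definition double_off :: "'v set \<Rightarrow> ('v::finite \<Rightarrow>\<^sub>0 nat) \<Rightarrow> ('v \<Rightarrow>\<^sub>0 nat)" where
  "double_off T u = exponent_of (\<lambda>x. if x \<in> T then lookup u x else 2 * lookup u x)"

lemma lookup_double_off:
  "lookup (double_off T u) x = (if x \<in> T then lookup u x else 2 * lookup u x)"
  by (simp add: double_off_def)

lemma le_double_off: "lookup u x \<le> lookup (double_off T u) x"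
  by (simp add: lookup_double_off)

text \<open>
  The choice \<open>T = UNIV\<close> stands for \<open>double_off T u = u\<close>, which allows a uniform treatment of
  the two cases.
\<close>
definition kept_vertices :: "'v set set \<Rightarrow> ('v \<Rightarrow>\<^sub>0 nat) \<Rightarrow> 'v set \<Rightarrow> bool" where
  "kept_vertices E u T \<longleftrightarrow> simple_triangle E u T \<or> T = UNIV \<and> (\<nexists>S. simple_triangle E u S)"

lemma triangle_card: "triangle E a b c \<Longrightarrow> card {a, b, c} = 3"
  by (auto simp: triangle_def)

text \<open>
  The cases are distinguished by the weight \<open>m\<close> of \<open>u\<close> on the neighbourhood \<open>W\<close> of the
  support of \<open>t\<close>. Only \<open>k = 3\<close>, \<open>m = 1\<close> needs the doubling: the rest of \<open>u\<close> may then be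
  in the symbolic square merely because of a triangle with exponents one, so \<open>T\<close> is a triangle. If the
  two differ, the former has a vertex outside \<open>T\<close>, which is doubled, and belongs to the ordinary
  square. If they agree,
  then the vertex of \<open>W\<close> is outside \<open>T\<close> and is doubled, so two edges into the support of
  \<open>t\<close> and one edge of \<open>T\<close> suffice.
\<close>
lemma symbolic_to_ordinary:
  fixes E :: "'v::finite set set"
  assumes graph: "is_graph E" and kept: "kept_vertices E u T" and k: "k \<in> {2, 3}"
    and u: "u \<notin> symbolic_exponents E k" and tu: "t + u \<in> symbolic_exponents E k"
  shows "scaled k t + double_off T u \<in> exponent_power (edge_exponents E) k"
proof (cases "t \<in> edge_exponents E")
  case True
  show ?thesis
    by (rule exponent_power_mono[OF scaled_edge_exponent[OF True] upward_closed_edge])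
      (simp add: lookup_add)
next
  case False
  let ?W = "neighbours E (keys t)"
  let ?r = "part_on (- (?W \<union> keys t))" and ?v = "double_off T u" and ?m = "weight ?W u"
  have rest: "?r u \<in> symbolic_exponents E (k - ?m)"
    by (rule symbolic_rest[OF graph False tu])
  have le: "lookup (?r u) x \<le> lookup (?r ?v) x" for x
    using le_double_off[of u x T] by (simp add: lookup_part_on)
  have m_le: "?m \<le> weight ?W ?v" by (intro weight_mono le_double_off)
  have "?m \<noteq> 0"
  proof
    assume "?m = 0"
    with rest have "?r u \<in> symbolic_exponents E k" by simp
    then have "u \<in> symbolic_exponents E k"
      by (rule symbolic_exponents_mono) (simp add: lookup_part_on)
    with u show False ..
  qed
  then consider "k \<le> ?m" | "?m < k" "k - ?m = 1" | "k = 3" "?m = 1" "k - ?m = 2"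
    using k by fastforce
  then show ?thesis
  proof cases
    case 1
    then show ?thesis using m_le by (intro power_from_rest[of k]) auto
  next
    case 2
    then have "?r u \<in> edge_exponents E" using rest symbolic_first_power[OF graph] by simp
    then have "?r u \<in> exponent_power (edge_exponents E) (k - ?m)"
      unfolding 2 by (rule in_exponent_power_one)
    then have "?r ?v \<in> exponent_power (edge_exponents E) (k - ?m)"
      by (rule exponent_power_mono[OF _ upward_closed_edge le])
    then show ?thesis using m_le 2 by (intro power_from_rest[of ?m]) auto
  next
    case 3
    show ?thesis
    proof (cases "?r ?v \<in> exponent_power (edge_exponents E) 2")
      case True
      then show ?thesis using m_le 3 by (intro power_from_rest[of 1]) auto
    next
      case False
      then have "?r u \<notin> exponent_power (edge_exponents E) 2"
        using exponent_power_mono[OF _ upward_closed_edge le] by blast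
      moreover have "?r u \<in> symbolic_exponents E 2" using rest unfolding 3(3) .
      ultimately obtain x y z where tri: "triangle E x y z"
        and one: "lookup (?r u) x = 1" "lookup (?r u) y = 1" "lookup (?r u) z = 1"
        using symbolic_square[OF graph] by metis
      have off: "p \<notin> ?W \<union> keys t \<and> lookup u p = 1" if "p \<in> {x, y, z}" for p
        using one that by (auto simp: lookup_part_on split: if_splits)
      then have "simple_triangle E u {x, y, z}" using tri unfolding simple_triangle_def by blast
      then obtain a b c where T: "T = {a, b, c}" "triangle E a b c"
        using kept unfolding kept_vertices_def simple_triangle_def by blast
      have r: "lookup (?r ?v) p = (if p \<in> T then 1 else 2)" if "p \<in> {x, y, z}" for p
        using off[OF that] by (simp add: lookup_part_on lookup_double_off)
      have pos: "0 < lookup (?r ?v) x" "0 < lookup (?r ?v) y" "0 < lookup (?r ?v) z"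
        using r[of x] r[of y] r[of z] by simp_all
      have "\<not> (1 < lookup (?r ?v) x \<or> 1 < lookup (?r ?v) y \<or> 1 < lookup (?r ?v) z)"
        using triangle_square[OF tri pos] False by blast
      then have "{x, y, z} \<subseteq> T" using r[of x] r[of y] r[of z] by (auto split: if_splits)
      then have xyz: "{x, y, z} = T"
        using triangle_card[OF tri] triangle_card[OF T(2)] T(1) by (intro card_subset_eq) auto
      obtain e where e: "e \<in> ?W" "0 < lookup u e"
        using weight_pos_iff[of ?W u] 3(2) by auto
      have "e \<notin> T" using e off xyz by blast
      then have "2 \<le> lookup ?v e" using e by (simp add: lookup_double_off)
      then have w: "2 \<le> weight ?W ?v" using weight_le[OF e(1), of ?v] by simp
      have "?r ?v \<in> edge_exponents E"
        unfolding edge_exponents_def mem_Collect_eq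
        using tri pos by - (rule exI[of _ x], rule exI[of _ y], simp add: triangle_def)
      then have "?r ?v \<in> exponent_power (edge_exponents E) (k - 2)"
        using in_exponent_power_one 3(1) by fastforce
      with w 3(1) show ?thesis by (intro power_from_rest[of 2]) linarith+
    qed
  qed
qed

text \<open>
  A cover contains two vertices of the triangle \<open>T\<close>. If it contains a further vertex of the support of
  \<open>u\<close>, its weight on \<open>u\<close> is already three; otherwise doubling does not affect its weight.
\<close>
lemma double_off_weight:
  fixes E :: "'v::finite set set"
  assumes "kept_vertices E u T" "k \<le> 3" "vertex_cover E C" "k \<le> weight C (double_off T u)"
  shows "k \<le> weight C u"
proof (cases "T = UNIV")
  case True
  have "double_off UNIV u = u" by (rule exponent_eqI) (simp add: lookup_double_off)
  with assms(4) show ?thesis unfolding True by (simp only:)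
next
  case False
  then have "simple_triangle E u T" using assms(1) by (simp add: kept_vertices_def)
  then obtain a b c where T: "T = {a, b, c}" and tri: "triangle E a b c"
    and one: "lookup u a = 1" "lookup u b = 1" "lookup u c = 1"
    unfolding simple_triangle_def by blast
  obtain p q where pq: "p \<in> C" "q \<in> C" "p \<in> T" "q \<in> T" "p \<noteq> q"
  proof -
    have "a \<in> C \<or> b \<in> C" "b \<in> C \<or> c \<in> C" "a \<in> C \<or> c \<in> C"
      using assms(3) tri by (auto simp: vertex_cover_def triangle_def)
    then consider "a \<in> C" "b \<in> C" | "b \<in> C" "c \<in> C" | "a \<in> C" "c \<in> C" by argo
    then show ?thesis
      using that[of a b] that[of b c] that[of a c] tri by cases (auto simp: T triangle_def)
  qed
  have u1: "lookup u p = 1" "lookup u q = 1" using pq one T by auto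
  show ?thesis
  proof (cases "\<exists>x\<in>C - T. 0 < lookup u x")
    case True
    then obtain x where x: "x \<in> C" "x \<notin> T" "0 < lookup u x" by blast
    have "p \<noteq> x" "q \<noteq> x" using pq x by auto
    then have "weight {p, q, x} u = 1 + (1 + lookup u x)"
      using pq(5) u1 by (simp add: weight_def)
    moreover have "weight {p, q, x} u \<le> weight C u"
      using pq x by (intro weight_subset_mono) auto
    ultimately show ?thesis using x assms(2) by linarith
  next
    case False
    then have "weight C (double_off T u) = weight C u"
      unfolding weight_def by (intro sum.cong) (auto simp: lookup_double_off)
    with assms(4) show ?thesis by simp
  qed
qed

text \<open>
  A cover that meets the support of \<open>t\<close> has weight at least \<open>k\<close> on \<open>scaled k t\<close>. On a
  cover that avoids it, \<open>t\<close> has no weight.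
\<close>
lemma ordinary_to_symbolic:
  fixes E :: "'v::finite set set"
  assumes kept: "kept_vertices E u T" and k: "k \<le> 3"
    and tv: "t + double_off T u \<in> exponent_power (edge_exponents E) k"
  shows "scaled k t + u \<in> symbolic_exponents E k"
  unfolding symbolic_exponents_def mem_Collect_eq
proof (intro allI impI)
  fix C assume C: "vertex_cover E C"
  have le: "k \<le> weight C t + weight C (double_off T u)"
    using tv edge_power_subset_symbolic[of E k] C unfolding symbolic_exponents_def weight_add[symmetric]
    by blast
  show "k \<le> weight C (scaled k t + u)"
  proof (cases "weight C t = 0")
    case True
    then have "k \<le> weight C u" using double_off_weight[OF kept k C] le by simp
    then show ?thesis by simp
  next
    case False
    have "weight C (scaled k t) = k * weight C t" by (simp add: weight_def sum_distrib_left)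
    with False have "k \<le> weight C (scaled k t)" by simp
    then show ?thesis by simp
  qed
qed

lemma kept_vertices_exist: "\<exists>T. kept_vertices E u T"
  unfolding kept_vertices_def by blast

section \<open>Ideals of a type-class ring\<close>

lemma ring_of_type_simps [simp]:
  "carrier ring_of_type_algebra = (UNIV :: 'a::comm_ring_1 set)"
  "x \<otimes>\<^bsub>ring_of_type_algebra\<^esub> y = x * y"
  "x \<oplus>\<^bsub>ring_of_type_algebra\<^esub> y = x + y"
  "\<one>\<^bsub>ring_of_type_algebra\<^esub> = (1 :: 'a)"
  "\<zero>\<^bsub>ring_of_type_algebra\<^esub> = (0 :: 'a)"
  for x y :: "'a::comm_ring_1"
  by (simp_all add: ring_of_type_algebra_def)

lemma ring_of_type_power [simp]:
  "x [^]\<^bsub>ring_of_type_algebra\<^esub> (n::nat) = x ^ n" for x :: "'a::comm_ring_1"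
proof -
  interpret cring "ring_of_type_algebra :: 'a ring" by (rule cring_from_type_algebra)
  show ?thesis by (induction n) (simp_all add: mult.commute)
qed

lemma ideal_ring_of_type_iff:
  fixes I :: "'a::comm_ring_1 set"
  shows "ideal I ring_of_type_algebra \<longleftrightarrow>
    0 \<in> I \<and> (\<forall>a\<in>I. \<forall>b\<in>I. a + b \<in> I) \<and> (\<forall>a\<in>I. \<forall>x. x * a \<in> I)" (is "_ \<longleftrightarrow> ?closed")
proof
  assume I: "ideal I (ring_of_type_algebra :: 'a ring)"
  note subgroup = ideal.axioms(1)[OF I]
  show ?closed
    using additive_subgroup.zero_closed[OF subgroup] additive_subgroup.a_closed[OF subgroup]
      ideal.I_l_closed[OF I] by simp
next
  assume closed: ?closed
  interpret cring "ring_of_type_algebra :: 'a ring" by (rule cring_from_type_algebra)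
  have neg: "\<ominus>\<^bsub>ring_of_type_algebra\<^esub> x = - x" for x :: 'a
    using minus_equality[of "- x" x] by simp
  show "ideal I (ring_of_type_algebra :: 'a ring)"
  proof (rule idealI)
    show "subgroup I (add_monoid (ring_of_type_algebra :: 'a ring))"
    proof (rule subgroup.intro)
      fix x assume "x \<in> I"
      then have "(- 1) * x \<in> I" using closed by blast
      then show "inv\<^bsub>add_monoid (ring_of_type_algebra :: 'a ring)\<^esub> x \<in> I"
        using neg[of x] by (simp add: a_inv_def)
    qed (use closed in auto)
  qed (use closed in \<open>auto simp: mult.commute intro: ring_axioms\<close>)
qed

lemma ideal_sum_closed:
  fixes I :: "'a::comm_ring_1 set"
  assumes "ideal I ring_of_type_algebra" "finite A" "\<And>x. x \<in> A \<Longrightarrow> f x \<in> I"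
  shows "sum f A \<in> I"
  using assms(2,3,1) by (induction) (auto simp: ideal_ring_of_type_iff)

text \<open>
  In the binomial expansion of \<open>(a + b)\<close> to the power \<open>m + n\<close>, each term is divisible by
  \<open>a ^ m\<close> or by \<open>b ^ n\<close>.
\<close>
lemma ideal_radical_ideal:
  fixes I :: "'a::comm_ring_1 set"
  assumes I: "ideal I ring_of_type_algebra"
  shows "ideal (ideal_radical ring_of_type_algebra I) ring_of_type_algebra"
proof -
  have mul: "x * a \<in> I" if "a \<in> I" for a x
    using I that by (simp add: ideal_ring_of_type_iff)
  have "a + b \<in> ideal_radical ring_of_type_algebra I"
    if ab: "a \<in> ideal_radical ring_of_type_algebra I" "b \<in> ideal_radical ring_of_type_algebra I" for a b
  proof -
    obtain m n where mn: "0 < m" "a ^ m \<in> I" "b ^ n \<in> I"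
      using ab by (auto simp: ideal_radical_def)
    have "of_nat (m + n choose k) * a ^ k * b ^ (m + n - k) \<in> I" if k: "k \<le> m + n" for k
    proof (cases "m \<le> k")
      case True
      then have "a ^ k = a ^ (k - m) * a ^ m" by (simp flip: power_add)
      then show ?thesis
        using mul[OF mn(2), of "of_nat (m + n choose k) * a ^ (k - m) * b ^ (m + n - k)"]
        by (simp add: ac_simps)
    next
      case False
      then have "m + n - k = (m - k) + n" by simp
      then have "b ^ (m + n - k) = b ^ (m - k) * b ^ n" by (simp only: power_add)
      then show ?thesis
        using mul[OF mn(3), of "of_nat (m + n choose k) * a ^ k * b ^ (m - k)"]
        by (simp add: ac_simps)
    qed
    then have "(a + b) ^ (m + n) \<in> I"
      unfolding binomial_ring by (intro ideal_sum_closed[OF I]) auto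
    then show ?thesis using mn(1) by (auto simp: ideal_radical_def intro!: exI[of _ "m + n"])
  qed
  moreover have "x * a \<in> ideal_radical ring_of_type_algebra I"
    if "a \<in> ideal_radical ring_of_type_algebra I" for a x
    using that mul by (auto simp: ideal_radical_def power_mult_distrib)
  moreover have "0 \<in> ideal_radical ring_of_type_algebra I"
    using I by (auto simp: ideal_radical_def ideal_ring_of_type_iff intro!: exI[of _ 1])
  ultimately show ?thesis by (auto simp: ideal_ring_of_type_iff)
qed

section \<open>Monomial ideals\<close>

definition monomial_span :: "('v \<Rightarrow>\<^sub>0 nat) set \<Rightarrow> ('v, 'k::field) mpol set" where
  "monomial_span M = {p. keys p \<subseteq> M}"

lemma sum_of_terms:
  fixes p :: "('v, 'k::field) mpol"
  shows "p = (\<Sum>t\<in>keys p. Poly_Mapping.single t (lookup p t))"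
proof (rule poly_mapping_eqI)
  fix s
  have "lookup (\<Sum>t\<in>keys p. Poly_Mapping.single t (lookup p t)) s
      = (\<Sum>t\<in>keys p. if t = s then lookup p t else 0)"
    by (simp add: lookup_sum lookup_single when_def)
  also have "\<dots> = lookup p s" by (simp add: in_keys_iff)
  finally show "lookup p s = lookup (\<Sum>t\<in>keys p. Poly_Mapping.single t (lookup p t)) s" by simp
qed

lemma monomial_span_least:
  fixes I :: "('v, 'k::field) mpol set"
  assumes "ideal I mpol_ring" "\<And>t c. t \<in> M \<Longrightarrow> Poly_Mapping.single t c \<in> I"
  shows "monomial_span M \<subseteq> I"
proof
  fix p :: "('v, 'k) mpol" assume "p \<in> monomial_span M"
  then have "(\<Sum>t\<in>keys p. Poly_Mapping.single t (lookup p t)) \<in> I"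
    using assms by (intro ideal_sum_closed) (auto simp: monomial_span_def)
  then show "p \<in> I" by (simp flip: sum_of_terms)
qed

lemma ideal_monomial_span:
  assumes "upward_closed M"
  shows "ideal (monomial_span M :: ('v, 'k::field) mpol set) mpol_ring"
proof -
  have "p + q \<in> monomial_span M" if "p \<in> monomial_span M" "q \<in> monomial_span M"
    for p q :: "('v, 'k) mpol"
    using that keys_add[of p q] by (auto simp: monomial_span_def)
  moreover have "p * q \<in> monomial_span M" if "q \<in> monomial_span M" for p q :: "('v, 'k) mpol"
    using that keys_mult[of p q] assms by (fastforce simp: monomial_span_def upward_closed_def)
  ultimately show ?thesis by (auto simp: ideal_ring_of_type_iff monomial_span_def)
qed

lemma monomial_in_span_iff [simp]:
  "monomial t \<in> (monomial_span M :: ('v, 'k::field) mpol set) \<longleftrightarrow> t \<in> M"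
  by (simp add: monomial_def monomial_span_def)

lemma ideal_prod_monomial_span:
  assumes "upward_closed M" "upward_closed N"
  shows "ideal_prod mpol_ring (monomial_span M) (monomial_span N)
    = (monomial_span {a + b | a b. a \<in> M \<and> b \<in> N} :: ('v, 'k::field) mpol set)" (is "?L = ?R")
proof
  interpret cring "mpol_ring :: ('v, 'k) mpol ring" by (rule cring_from_type_algebra)
  show "?L \<subseteq> ?R"
  proof
    fix p :: "('v, 'k) mpol" assume "p \<in> ?L"
    then show "p \<in> ?R"
    proof induction
      case (prod p q)
      then show ?case using keys_mult[of p q] by (fastforce simp: monomial_span_def)
    next
      case (sum p q)
      then show ?case using keys_add[of p q] by (auto simp: monomial_span_def)
    qed
  qed
  show "?R \<subseteq> ?L"
  proof (rule monomial_span_least)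
    show "ideal ?L mpol_ring" by (intro ideal_prod_is_ideal ideal_monomial_span assms)
  next
    fix t and c :: 'k assume "t \<in> {a + b | a b. a \<in> M \<and> b \<in> N}"
    then obtain a b where ab: "t = a + b" "a \<in> M" "b \<in> N" by blast
    have "Poly_Mapping.single a c \<otimes>\<^bsub>mpol_ring\<^esub> Poly_Mapping.single b 1 \<in> ?L"
      using ab by (intro ideal_prod.prod) (auto simp: monomial_span_def)
    then show "Poly_Mapping.single t c \<in> ?L" using ab by (simp add: mult_single)
  qed
qed

lemma ideal_power_monomial_span:
  assumes "upward_closed M"
  shows "ideal_power mpol_ring (monomial_span M) k
    = (monomial_span (exponent_power M k) :: ('v, 'k::field) mpol set)"
proof (induction k)
  case 0
  show ?case by (simp add: ideal_power_def nat_pow_def ideals_set_def monomial_span_def)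
next
  case (Suc k)
  have "ideal_power mpol_ring (monomial_span M :: ('v, 'k) mpol set) (Suc k)
      = ideal_prod mpol_ring (ideal_power mpol_ring (monomial_span M) k) (monomial_span M)"
    by (simp add: ideal_power_def nat_pow_def ideals_set_def)
  then show ?case
    by (simp add: Suc ideal_prod_monomial_span upward_closed_power assms)
qed

lemma edge_ideal_eq_span:
  fixes E :: "'v::finite set set"
  assumes "is_graph E"
  shows "edge_ideal E = (monomial_span (edge_exponents E) :: ('v, 'k::field) mpol set)"
proof
  let ?G = "{var i * var j | i j. {i, j} \<in> E} :: ('v, 'k) mpol set"
  have gen: "var i * var j = (monomial (Poly_Mapping.single i 1 + Poly_Mapping.single j 1) :: ('v, 'k) mpol)"
    for i j
    by (simp add: var_def monomial_def mult_single)
  have "?G \<subseteq> monomial_span (edge_exponents E)"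
    using edge_in_edge_exponents[of _ _ E] by (auto simp: gen simp del: One_nat_def)
  then show "edge_ideal E \<subseteq> (monomial_span (edge_exponents E) :: ('v, 'k) mpol set)"
    unfolding edge_ideal_def genideal_def using ideal_monomial_span[OF upward_closed_edge] by blast
  have "monomial_span (edge_exponents E) \<subseteq> I" if I: "ideal I mpol_ring" "?G \<subseteq> I"
    for I :: "('v, 'k) mpol set"
  proof (rule monomial_span_least[OF I(1)])
    fix t and c :: 'k assume "t \<in> edge_exponents E"
    then obtain i j where ij: "{i, j} \<in> E" "0 < lookup t i" "0 < lookup t j"
      by (auto simp: edge_exponents_def)
    have "i \<noteq> j" using ij(1) assms by (auto simp: is_graph_def)
    then obtain r where r: "t = r + (Poly_Mapping.single i 1 + Poly_Mapping.single j 1)"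
      using exponent_difference[of "Poly_Mapping.single i 1 + Poly_Mapping.single j 1" t] ij(2,3)
      by (fastforce simp: lookup_add lookup_single when_def)
    have "var i * var j \<in> I" using I(2) ij(1) by blast
    then have "Poly_Mapping.single r c * (var i * var j) \<in> I"
      using I(1) by (simp add: ideal_ring_of_type_iff)
    then show "Poly_Mapping.single t c \<in> I"
      by (simp only: gen monomial_def mult_single r mult_1_right)
  qed
  then show "monomial_span (edge_exponents E) \<subseteq> (edge_ideal E :: ('v, 'k) mpol set)"
    unfolding edge_ideal_def genideal_def by blast
qed

section \<open>Symbolic powers of edge ideals\<close>

text \<open>
  The sum found here serves as the leading term in the proof that a product of polynomials does not
  vanish. The variables are treated one after the other: keep only those members of \<open>A\<close> and of
  \<open>B\<close> whose exponent in the current variable is maximal. A sum of two maxima arises only from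
  members that are both maximal.
\<close>
lemma unique_sum_pair:
  fixes A B :: "('v::finite \<Rightarrow>\<^sub>0 nat) set"
  assumes "finite A" "finite B" "A \<noteq> {}" "B \<noteq> {}"
  obtains a b where "a \<in> A" "b \<in> B"
    "\<And>a' b'. a' \<in> A \<Longrightarrow> b' \<in> B \<Longrightarrow> a' + b' = a + b \<Longrightarrow> a' = a \<and> b' = b"
proof -
  have "\<exists>a\<in>A. \<exists>b\<in>B. \<forall>a'\<in>A. \<forall>b'\<in>B. a' + b' = a + b \<longrightarrow>
      (\<forall>x\<in>V. lookup a' x = lookup a x \<and> lookup b' x = lookup b x)"
    if "finite V" for V
    using that assms
  proof (induction V arbitrary: A B)
    case empty
    then show ?case by auto
  next
    case (insert x V)
    have top: "\<exists>m. \<exists>c\<in>C. lookup c x = m \<and> (\<forall>c\<in>C. lookup c x \<le> m)"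
      if "finite C" "C \<noteq> {}" for C :: "('v \<Rightarrow>\<^sub>0 nat) set"
    proof -
      have "Max ((\<lambda>c. lookup c x) ` C) \<in> (\<lambda>c. lookup c x) ` C"
        using that by (intro Max_in) auto
      moreover have "\<forall>c\<in>C. lookup c x \<le> Max ((\<lambda>c. lookup c x) ` C)"
        using that by auto
      ultimately show ?thesis by force
    qed
    obtain m where m: "\<exists>c\<in>A. lookup c x = m" "\<forall>c\<in>A. lookup c x \<le> m"
      using top[of A] insert.prems by blast
    obtain n where n: "\<exists>c\<in>B. lookup c x = n" "\<forall>c\<in>B. lookup c x \<le> n"
      using top[of B] insert.prems by blast
    let ?A = "{c \<in> A. lookup c x = m}" and ?B = "{c \<in> B. lookup c x = n}"
    have "finite ?A" "finite ?B" "?A \<noteq> {}" "?B \<noteq> {}" using insert.prems m n by auto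
    from insert.IH[OF this] obtain a b where ab: "a \<in> ?A" "b \<in> ?B"
      and uniq: "\<forall>a'\<in>?A. \<forall>b'\<in>?B. a' + b' = a + b \<longrightarrow>
        (\<forall>x\<in>V. lookup a' x = lookup a x \<and> lookup b' x = lookup b x)" by blast
    have "\<forall>y\<in>insert x V. lookup a' y = lookup a y \<and> lookup b' y = lookup b y"
      if ab': "a' \<in> A" "b' \<in> B" "a' + b' = a + b" for a' b'
    proof -
      have "lookup a' x + lookup b' x = m + n"
        using arg_cong[OF ab'(3), of "\<lambda>t. lookup t x"] ab by (simp add: lookup_add)
      moreover have "lookup a' x \<le> m" "lookup b' x \<le> n" using m(2) n(2) ab' by auto
      ultimately have "lookup a' x = m" "lookup b' x = n" by linarith+
      then have mem: "a' \<in> ?A" "b' \<in> ?B" using ab'(1,2) by simp_all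
      then have "\<forall>y\<in>V. lookup a' y = lookup a y \<and> lookup b' y = lookup b y"
        using uniq ab'(3) by blast
      with mem ab show ?thesis by simp
    qed
    then show ?case using ab by blast
  qed
  from this[of UNIV] obtain a b where ab: "a \<in> A" "b \<in> B"
    and uniq: "\<forall>a'\<in>A. \<forall>b'\<in>B. a' + b' = a + b \<longrightarrow>
      (\<forall>x\<in>UNIV. lookup a' x = lookup a x \<and> lookup b' x = lookup b x)" by auto
  show ?thesis
  proof (rule that[OF ab])
    fix a' b' assume "a' \<in> A" "b' \<in> B" "a' + b' = a + b"
    then have "\<forall>x. lookup a' x = lookup a x \<and> lookup b' x = lookup b x" using uniq by blast
    then show "a' = a \<and> b' = b" by (simp add: exponent_eqI)
  qed
qed

lemma lookup_times:
  fixes p q :: "('v, 'k::field) mpol"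
  shows "lookup (p * q) k
    = (\<Sum>(s, t)\<in>keys p \<times> keys q. if s + t = k then lookup p s * lookup q t else 0)"
proof -
  have "p * q = (\<Sum>s\<in>keys p. Poly_Mapping.single s (lookup p s)) *
      (\<Sum>t\<in>keys q. Poly_Mapping.single t (lookup q t))"
    by (simp flip: sum_of_terms)
  also have "\<dots> = (\<Sum>(s, t)\<in>keys p \<times> keys q. Poly_Mapping.single (s + t) (lookup p s * lookup q t))"
    by (simp add: sum_product mult_single sum.cartesian_product)
  finally show ?thesis
    by (simp add: lookup_sum lookup_single when_def split_def)
qed

text \<open>
  If neither \<open>p\<close> nor \<open>q\<close> is in the ideal, both have terms without variables from \<open>C\<close>. Among
  these, a pair of exponents whose sum arises in no other way gives a term of \<open>p * q\<close> without variables
  from \<open>C\<close> that cannot cancel.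
\<close>
lemma primeideal_variables:
  fixes C :: "'v::finite set"
  shows "primeideal (monomial_span (cover_exponents C) :: ('v, 'k::field) mpol set) mpol_ring"
    (is "primeideal ?P _")
proof (rule primeidealI)
  show "ideal ?P mpol_ring" by (rule ideal_monomial_span[OF upward_closed_cover])
  show "cring (mpol_ring :: ('v, 'k) mpol ring)" by (rule cring_from_type_algebra)
  have "(monomial 0 :: ('v, 'k) mpol) \<notin> ?P" by (simp add: cover_exponents_def)
  then show "carrier mpol_ring \<noteq> ?P" by (metis UNIV_I ring_of_type_simps(1))
next
  fix p q :: "('v, 'k) mpol"
  assume "p \<otimes>\<^bsub>mpol_ring\<^esub> q \<in> ?P"
  then have pq: "p * q \<in> ?P" by simp
  show "p \<in> ?P \<or> q \<in> ?P"
  proof (rule ccontr)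
    assume "\<not> (p \<in> ?P \<or> q \<in> ?P)"
    let ?A = "keys p - cover_exponents C" and ?B = "keys q - cover_exponents C"
    have "?A \<noteq> {}" "?B \<noteq> {}"
      using \<open>\<not> (p \<in> ?P \<or> q \<in> ?P)\<close> by (auto simp: monomial_span_def)
    then obtain a b where ab: "a \<in> ?A" "b \<in> ?B"
      and uniq: "\<And>a' b'. a' \<in> ?A \<Longrightarrow> b' \<in> ?B \<Longrightarrow> a' + b' = a + b \<Longrightarrow> a' = a \<and> b' = b"
      by (rule unique_sum_pair[of ?A ?B, rotated 2]) auto
    have out: "s + t \<notin> cover_exponents C \<longleftrightarrow> s \<notin> cover_exponents C \<and> t \<notin> cover_exponents C" for s t
      by (auto simp: cover_exponents_def lookup_add)
    have "lookup (p * q) (a + b)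
      = (\<Sum>(s, t)\<in>keys p \<times> keys q. if (s, t) = (a, b) then lookup p s * lookup q t else 0)"
      unfolding lookup_times
    proof (rule sum.cong[OF refl], clarify)
      fix s t assume st: "s \<in> keys p" "t \<in> keys q"
      have "s + t = a + b \<longleftrightarrow> (s, t) = (a, b)"
        using st ab uniq[of s t] out[of s t] out[of a b] by auto
      then show "(if s + t = a + b then lookup p s * lookup q t else 0)
        = (if (s, t) = (a, b) then lookup p s * lookup q t else 0)" by simp
    qed
    also have "\<dots> = (\<Sum>z\<in>keys p \<times> keys q. if z = (a, b) then lookup p a * lookup q b else 0)"
      by (intro sum.cong) (auto split: if_splits)
    also have "\<dots> = lookup p a * lookup q b" using ab by simp
    finally have "a + b \<in> keys (p * q)" using ab by (auto simp: in_keys_iff)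
    moreover have "a + b \<notin> cover_exponents C" using ab out by blast
    ultimately show False using pq by (auto simp: monomial_span_def)
  qed
qed

lemma var_in_variables_iff:
  "var x \<in> (monomial_span (cover_exponents C) :: ('v, 'k::field) mpol set) \<longleftrightarrow> x \<in> C"
  unfolding var_def monomial_in_span_iff cover_exponents_def mem_Collect_eq lookup_single when_def
  by (simp split: if_split)

lemma edge_ideal_subset_variables:
  fixes E :: "'v::finite set set"
  assumes "is_graph E" "vertex_cover E C"
  shows "edge_ideal E \<subseteq> (monomial_span (cover_exponents C) :: ('v, 'k::field) mpol set)"
proof -
  have "edge_exponents E \<subseteq> cover_exponents C" by (rule edge_exponents_subset_cover[OF assms(2)])
  then show ?thesis unfolding edge_ideal_eq_span[OF assms(1)] by (auto simp: monomial_span_def)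
qed

lemma prime_contains_variables:
  fixes Q :: "('v::finite, 'k::field) mpol set"
  assumes graph: "is_graph E" and Q: "primeideal Q mpol_ring" "edge_ideal E \<subseteq> Q"
  defines "C \<equiv> {x. var x \<in> Q}"
  shows "vertex_cover E C" "monomial_span (cover_exponents C) \<subseteq> Q"
proof -
  have ideal: "ideal Q mpol_ring" using Q(1) by (rule primeideal.axioms)
  show "vertex_cover E C"
    unfolding vertex_cover_def
  proof
    fix e assume e: "e \<in> E"
    obtain x y where xy: "e = {x, y}" using graph_edgeE[OF graph e] by metis
    have "var x * var y = (monomial (Poly_Mapping.single x 1 + Poly_Mapping.single y 1) :: ('v, 'k) mpol)"
      by (simp add: var_def monomial_def mult_single)
    also have "\<dots> \<in> edge_ideal E"
      unfolding edge_ideal_eq_span[OF graph] monomial_in_span_iff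
      using e xy by (intro edge_in_edge_exponents) simp
    finally have "var x * var y \<in> Q" using Q(2) by blast
    then have "var x \<in> Q \<or> var y \<in> Q"
      using primeideal.I_prime[OF Q(1), of "var x" "var y"] by simp
    then show "e \<inter> C \<noteq> {}" using xy by (auto simp: C_def)
  qed
  show "monomial_span (cover_exponents C) \<subseteq> Q"
  proof (rule monomial_span_least[OF ideal])
    fix t and c :: 'k assume "t \<in> cover_exponents C"
    then obtain x where x: "var x \<in> Q" "0 < lookup t x" by (auto simp: cover_exponents_def C_def)
    obtain r where "t = r + Poly_Mapping.single x 1" using split_off_variable[OF x(2)] .
    then have "Poly_Mapping.single t c = Poly_Mapping.single r c * var x"
      by (simp add: var_def monomial_def mult_single)
    then show "Poly_Mapping.single t c \<in> Q"
      using x(1) ideal by (simp add: ideal_ring_of_type_iff)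
  qed
qed

text \<open>
  A prime that contains the edge ideal contains an end of each edge, hence the prime generated by
  some vertex cover. So minimal primes come from vertex covers, and each minimal cover gives a minimal
  prime.
\<close>
lemma symbolic_power_edge_ideal:
  fixes E :: "'v::finite set set"
  assumes graph: "is_graph E"
  shows "symbolic_power mpol_ring (edge_ideal E) k
    = (monomial_span (symbolic_exponents E k) :: ('v, 'k::field) mpol set)"
proof
  let ?I = "edge_ideal E :: ('v, 'k) mpol set"
  let ?P = "\<lambda>C. monomial_span (cover_exponents C) :: ('v, 'k) mpol set"
  have power: "ideal_power mpol_ring (?P C) k = monomial_span {t. k \<le> weight C t}" for C :: "'v set"
    by (simp add: ideal_power_monomial_span upward_closed_cover exponent_power_cover)
  show "symbolic_power mpol_ring ?I k \<subseteq> monomial_span (symbolic_exponents E k)"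
  proof
    fix p assume p: "p \<in> symbolic_power mpol_ring ?I k"
    have "k \<le> weight C t" if t: "t \<in> keys p" and C: "vertex_cover E C" for t C
    proof -
      obtain D where D: "vertex_cover E D" "D \<subseteq> C"
        and least: "\<And>D'. vertex_cover E D' \<Longrightarrow> D' \<subseteq> D \<Longrightarrow> D' = D"
        using finite_has_minimal2[of "{D. vertex_cover E D}" C] C by auto
      have "?P D \<in> minimal_primes mpol_ring ?I"
        unfolding minimal_primes_def mem_Collect_eq
      proof (intro conjI allI impI)
        show "primeideal (?P D) mpol_ring" by (rule primeideal_variables)
        show "?I \<subseteq> ?P D" by (rule edge_ideal_subset_variables[OF graph D(1)])
        fix Q :: "('v, 'k) mpol set"
        assume "primeideal Q mpol_ring \<and> ?I \<subseteq> Q \<and> Q \<subseteq> ?P D"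
        then have Q: "primeideal Q mpol_ring" "?I \<subseteq> Q" "Q \<subseteq> ?P D" by simp_all
        note vars = prime_contains_variables[OF graph Q(1,2)]
        have "{x. var x \<in> Q} \<subseteq> D"
        proof
          fix x assume "x \<in> {x. var x \<in> Q}"
          then have "(var x :: ('v, 'k) mpol) \<in> ?P D" using Q(3) by (simp add: subsetD)
          then show "x \<in> D" by (rule var_in_variables_iff[THEN iffD1])
        qed
        with vars(1) have "{x. var x \<in> Q} = D" by (rule least)
        then show "Q = ?P D" using vars(2) Q(3) by simp
      qed
      then have "p \<in> monomial_span {t. k \<le> weight D t}"
        using p unfolding symbolic_power_def power[symmetric] by blast
      then have "k \<le> weight D t" using t by (auto simp: monomial_span_def)
      also have "\<dots> \<le> weight C t" by (rule weight_subset_mono[OF D(2)])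
      finally show ?thesis .
    qed
    then show "p \<in> monomial_span (symbolic_exponents E k)"
      by (auto simp: monomial_span_def symbolic_exponents_def)
  qed
  show "monomial_span (symbolic_exponents E k) \<subseteq> symbolic_power mpol_ring ?I k"
  proof
    fix p :: "('v, 'k) mpol" assume p: "p \<in> monomial_span (symbolic_exponents E k)"
    have "p \<in> ideal_power mpol_ring P k" if P: "P \<in> minimal_primes mpol_ring ?I" for P
    proof -
      define C :: "'v set" where "C = {x. var x \<in> P}"
      have prime: "primeideal P mpol_ring" "?I \<subseteq> P" using P by (auto simp: minimal_primes_def)
      have C: "vertex_cover E C" "?P C \<subseteq> P"
        using prime_contains_variables[OF graph prime] by (simp_all add: C_def)
      then have "?P C = P"
        using P primeideal_variables edge_ideal_subset_variables[OF graph C(1)]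
        unfolding minimal_primes_def by blast
      moreover have "p \<in> monomial_span {t. k \<le> weight C t}"
        using p C(1) by (auto simp: monomial_span_def symbolic_exponents_def)
      ultimately show ?thesis using power by metis
    qed
    then show "p \<in> symbolic_power mpol_ring ?I k" by (simp add: symbolic_power_def)
  qed
qed

section \<open>Radicals of colon ideals\<close>

lemma lookup_times_monomial:
  "lookup (p * monomial u) (t + u) = (lookup p t :: 'k::field)"
proof -
  have "lookup (p * monomial u) (t + u) = (\<Sum>s\<in>keys p. if s + u = t + u then lookup p s else 0)"
    by (simp add: lookup_times monomial_def flip: sum.cartesian_product)
  also have "\<dots> = lookup p t" by (simp add: in_keys_iff)
  finally show ?thesis .
qed

lemma single_power:
  fixes t :: "'v::finite \<Rightarrow>\<^sub>0 nat" and c :: "'k::field"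
  shows "Poly_Mapping.single t c ^ n = Poly_Mapping.single (scaled n t) (c ^ n)"
  by (induction n) (simp_all add: scaled_Suc mult_single add.commute)

lemma ideal_colon:
  fixes I :: "'a::comm_ring_1 set"
  assumes "ideal I ring_of_type_algebra"
  shows "ideal (colon ring_of_type_algebra I u) ring_of_type_algebra"
  using assms by (auto simp: ideal_ring_of_type_iff colon_def distrib_right mult.assoc)

text \<open>
  If a power of \<open>f\<close> is in the first colon ideal, a monomial ideal, then so are the terms of that power.
  They are in the second radical by assumption, hence so is their sum, and finally \<open>f\<close>.
\<close>
lemma radical_colon_mono:
  fixes u v :: "'v::finite \<Rightarrow>\<^sub>0 nat"
  assumes N: "upward_closed N" and k: "0 < k"
    and MN: "\<And>t. t + u \<in> M \<Longrightarrow> scaled k t + v \<in> N"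
  shows "ideal_radical mpol_ring (colon mpol_ring (monomial_span M) (monomial u))
    \<subseteq> (ideal_radical mpol_ring (colon mpol_ring (monomial_span N) (monomial v))
        :: ('v, 'k::field) mpol set)" (is "_ \<subseteq> ?R")
proof
  fix f :: "('v, 'k) mpol"
  assume "f \<in> ideal_radical mpol_ring (colon mpol_ring (monomial_span M) (monomial u))"
  then obtain n where n: "0 < n" "keys (f ^ n * monomial u) \<subseteq> M"
    by (auto simp: ideal_radical_def colon_def monomial_span_def)
  have "ideal ?R mpol_ring"
    by (intro ideal_radical_ideal ideal_colon ideal_monomial_span N)
  moreover have "Poly_Mapping.single t c \<in> ?R" if t: "t \<in> keys (f ^ n)" for t and c :: 'k
  proof -
    have "t + u \<in> M"
      using n(2) t lookup_times_monomial[of "f ^ n" u t] by (auto simp: in_keys_iff)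
    then have "Poly_Mapping.single t c ^ k * monomial v \<in> monomial_span N"
      using MN by (simp add: single_power monomial_def mult_single monomial_span_def)
    then show ?thesis using k by (auto simp: ideal_radical_def colon_def)
  qed
  ultimately have "monomial_span (keys (f ^ n)) \<subseteq> ?R" by (rule monomial_span_least)
  then have "f ^ n \<in> ?R" by (auto simp: monomial_span_def)
  then obtain m where "0 < m" "f ^ (n * m) \<in> colon mpol_ring (monomial_span N) (monomial v)"
    by (auto simp: ideal_radical_def power_mult)
  then show "f \<in> ?R" using n(1) unfolding ideal_radical_def
    by (simp only: ring_of_type_simps ring_of_type_power mem_Collect_eq)
      (auto intro: exI[of _ "n * m"])
qed

theorem theorem4p4:
  fixes E :: "'v::finite set set" and k :: nat
  assumes "is_graph E"
    and "k \<in> {2, 3}"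
  shows "assrad (symbolic_power mpol_ring (edge_ideal E :: ('v, 'k::field) mpol set) k)
       \<subseteq> assrad (ideal_power mpol_ring (edge_ideal E :: ('v, 'k) mpol set) k)"
proof
  let ?S = "symbolic_exponents E k" and ?N = "exponent_power (edge_exponents E) k"
  have k: "0 < k" "k \<le> 3" using assms(2) by auto
  fix J assume "J \<in> assrad (symbolic_power mpol_ring (edge_ideal E :: ('v, 'k) mpol set) k)"
  then obtain u where u: "u \<notin> ?S"
    and J: "J = ideal_radical mpol_ring (colon mpol_ring (monomial_span ?S) (monomial u))"
    unfolding assrad_def symbolic_power_edge_ideal[OF assms(1)] by auto
  obtain T where T: "kept_vertices E u T" using kept_vertices_exist by blast
  let ?v = "double_off T u"
  have "J = ideal_radical mpol_ring (colon mpol_ring (monomial_span ?N) (monomial ?v))"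
    unfolding J
  proof (rule equalityI; rule radical_colon_mono[OF _ k(1)])
    show "upward_closed ?N" by (rule upward_closed_power[OF upward_closed_edge])
    show "upward_closed ?S"
      unfolding upward_closed_def
      by (auto simp: lookup_add elim!: symbolic_exponents_mono)
    show "scaled k t + ?v \<in> ?N" if "t + u \<in> ?S" for t
      by (rule symbolic_to_ordinary[OF assms(1) T assms(2) u that])
    show "scaled k t + u \<in> ?S" if "t + ?v \<in> ?N" for t
      by (rule ordinary_to_symbolic[OF T k(2) that])
  qed
  moreover have "?v \<notin> ?N"
  proof
    assume "?v \<in> ?N"
    then have "scaled k 0 + u \<in> ?S" by (intro ordinary_to_symbolic[OF T k(2)]) simp
    moreover have "scaled k 0 = (0 :: 'v \<Rightarrow>\<^sub>0 nat)" by (rule exponent_eqI) simp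
    ultimately show False using u by simp
  qed
  ultimately show "J \<in> assrad (ideal_power mpol_ring (edge_ideal E :: ('v, 'k) mpol set) k)"
    unfolding assrad_def edge_ideal_eq_span[OF assms(1)]
      ideal_power_monomial_span[OF upward_closed_edge] by auto
qed

end
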